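(* Let $n\ge 1$ and $\tau\in G_{n-1}$, and put $c=2(1+\tau(X_{n-1}))^{-1}\in\mathbb{R}$. Define the real sequence $a_0=1$, $a_{2k-1}=c$, $a_{2k}=2$ for $k\ge1$, and $p_{-1}=1$, $p_0=a_0$, $q_{-1}=0$, $q_0=1$, $p_k=a_kp_{k-1}+p_{k-2}$, $q_k=a_kq_{k-1}+q_{k-2}$ for $k\ge1$. Then the convergents $p_k/q_k$ are defined and converge, and \[ \sqrt{2+\tau(X_{n-1})}=\lim_{k\to\infty}\frac{p_k}{q_k}=[1,\overline{2(1+\tau(X_{n-1}))^{-1},2}]. \]
   Context: $X_j=2\cos(2\pi/2^{j+2})$ for $j\ge0$ (so $X_0=0$, $X_j=\sqrt{2+X_{j-1}}$), $\mathbb{B}_j=\mathbb{Q}(X_j)$, $G_j=\mathrm{Gal}(\mathbb{B}_j/\mathbb{Q})$; elements $\tau\in G_{n-1}$ are viewed as real embeddings of $\mathbb{B}_{n-1}$. The notation $[a_0,a_1,\dots]$ denotes the continued fraction $a_0+\cfrac{1}{a_1+\cdots}$, i.e. the limit of $[a_0,\dots,a_k]=p_k/q_k$, and $[a_0,\overline{b_1,b_2}]$ denotes $[a_0,b_1,b_2,b_1,b_2,\dots]$. The square root is the positive one. *)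

theory Defs
  imports "HOL-Algebra.Algebraic_Closure_Type" "HOL-Algebra.Generated_Fields"
    "HOL-Algebra.Bij"
begin

abbreviation real_field :: "real ring"
  where "real_field \<equiv> ring_of_type_algebra"

definition XB :: "nat \<Rightarrow> real"
  where "XB j = 2 * cos (2 * pi / 2 ^ (j + 2))"

lemma XB_0: "XB 0 = 0"
  by (simp add: XB_def)

lemma XB_Suc: "XB (Suc j) = sqrt (2 + XB j)"
proof -
  define t :: real where "t = 2 * pi / 2 ^ (Suc j + 2)"
  have t: "0 \<le> t" "t \<le> pi / 2"
  proof -
    have "(4::real) \<le> 2 ^ (Suc j + 2)"
      using power_increasing[of 2 "Suc j + 2" "2::real"] by simp
    then have "2 * pi / 2 ^ (Suc j + 2) \<le> 2 * pi / 4"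
      by (intro divide_left_mono) auto
    then show "0 \<le> t" "t \<le> pi / 2" by (auto simp: t_def)
  qed
  have "XB j = 2 * cos (2 * t)" by (simp add: XB_def t_def)
  then have "2 + XB j = (2 * cos t)\<^sup>2"
    by (simp add: cos_double_cos power2_eq_square)
  moreover have "cos t \<ge> 0" using t by (intro cos_ge_zero) auto
  ultimately have "sqrt (2 + XB j) = 2 * cos t"
    by (intro real_sqrt_unique) auto
  then show ?thesis by (simp add: XB_def t_def)
qed

definition BF :: "nat \<Rightarrow> real set"
  where "BF j = generate_field real_field (\<rat> \<union> {XB j})"

text \<open>As for \<^const>\<open>Bij\<close>, only functions that are extensional on \<open>L\<close> are taken, so that
  distinct elements are distinct automorphisms of \<open>L\<close>.\<close>

definition Gal :: "real set \<Rightarrow> real set \<Rightarrow> (real \<Rightarrow> real) monoid"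
  where "Gal L K = BijGroup L
    \<lparr>carrier := {\<sigma> \<in> ring_iso (real_field\<lparr>carrier := L\<rparr>) (real_field\<lparr>carrier := L\<rparr>) \<inter> Bij L.
                  \<forall>x\<in>K. \<sigma> x = x}\<rparr>"

definition GB :: "nat \<Rightarrow> (real \<Rightarrow> real) monoid"
  where "GB j = Gal (BF j) \<rat>"

text \<open>\<open>cfrac_fin k a\<close> is the nested fraction \<open>[a 0, \<dots>, a k]\<close>; \<open>cfrac_defined k a\<close> says that
  no division by zero occurs when it is evaluated.\<close>

primrec cfrac_fin :: "nat \<Rightarrow> (nat \<Rightarrow> real) \<Rightarrow> real"
  where
    "cfrac_fin 0 a = a 0"
  | "cfrac_fin (Suc k) a = a 0 + 1 / cfrac_fin k (\<lambda>i. a (Suc i))"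

primrec cfrac_defined :: "nat \<Rightarrow> (nat \<Rightarrow> real) \<Rightarrow> bool"
  where
    "cfrac_defined 0 a = True"
  | "cfrac_defined (Suc k) a \<longleftrightarrow>
       cfrac_defined k (\<lambda>i. a (Suc i)) \<and> cfrac_fin k (\<lambda>i. a (Suc i)) \<noteq> 0"

text \<open>\<open>x = [a 0, a 1, \<dots>]\<close>\<close>

definition has_cfrac :: "real \<Rightarrow> (nat \<Rightarrow> real) \<Rightarrow> bool"
  where "has_cfrac x a \<longleftrightarrow>
    (\<forall>k. cfrac_defined k a) \<and> (\<lambda>k. cfrac_fin k a) \<longlonglongrightarrow> x"

text \<open>The entries of \<open>[a0, b1, b2, b1, b2, \<dots>]\<close>, with \<open>b1, b2\<close> repeating.\<close>

definition periodic2 :: "real \<Rightarrow> real \<Rightarrow> real \<Rightarrow> nat \<Rightarrow> real"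
  where "periodic2 a0 b1 b2 i = (if i = 0 then a0 else if odd i then b1 else b2)"

end

theory Submission
  imports Defs
begin

text \<open>
  Put \<open>t = \<tau>(X\<^bsub>n-1\<^esub>)\<close>, \<open>s = \<surd>(2 + t)\<close> and \<open>f x = x\<^sup>2 - 2\<close>. Since \<open>f\<close> maps
  \<open>X\<^bsub>j+1\<^esub>\<close> to \<open>X\<^bsub>j\<^esub>\<close>, some iterate of \<open>f\<close> kills \<open>X\<^bsub>n-1\<^esub>\<close>, hence also its conjugate
  \<open>t\<close>. The orbit of a point of \<open>{x. \<bar>x\<bar> \<ge> 2} \<union> {-1}\<close> under \<open>f\<close> never reaches \<open>0\<close>; so
  \<open>\<bar>t\<bar> < 2\<close> and \<open>t \<noteq> -1\<close>, i.e. \<open>0 < s\<close> and \<open>s \<noteq> 1\<close>. The partial quotient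
  \<open>c = 2 / (s\<^sup>2 - 1)\<close> may be negative, but with \<open>v m = (1 + s)\<^sup>m - (1 - s)\<^sup>m > 0\<close> and
  \<open>v (m + 2) = 2 v (m + 1) + (s\<^sup>2 - 1) v m\<close> the \<open>k\<close>-th convergent is
  \<open>v (k + 2) / v (k + 1) - 1\<close>, which tends to \<open>s\<close> because \<open>\<bar>1 - s\<bar> < 1 + s\<close>.
\<close>

text \<open>Up to the factor \<open>2 * s\<close> this is the Lucas sequence of x^2 = 2 x + (s^2 -
  1), whose roots are 1 + s and 1 - s. The factor cancels in all ratios.\<close>

definition lucas :: "real \<Rightarrow> nat \<Rightarrow> real"
  where "lucas s m = (1 + s) ^ m - (1 - s) ^ m"

lemma lucas_pos:
  assumes "0 < s" "0 < m"
  shows "0 < lucas s m"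
proof -
  have "(1 - s) ^ m \<le> \<bar>1 - s\<bar> ^ m"
    by (metis abs_ge_self power_abs)
  also have "\<dots> < (1 + s) ^ m"
    using assms by (intro power_strict_mono) auto
  finally show ?thesis
    by (simp add: lucas_def)
qed

lemma lucas_rec: "lucas s (Suc (Suc m)) = 2 * lucas s (Suc m) + (s\<^sup>2 - 1) * lucas s m"
  by (simp add: lucas_def algebra_simps power2_eq_square)

lemma lucas_ratio_tendsto:
  assumes "0 < s"
  shows "(\<lambda>k. lucas s (k + 2) / lucas s (k + 1)) \<longlonglongrightarrow> 1 + s"
proof -
  define r where "r = (1 - s) / (1 + s)"
  have "\<bar>r\<bar> < 1"
    using assms by (auto simp: r_def abs_if field_simps)
  then have r: "(\<lambda>k. r ^ k) \<longlonglongrightarrow> 0"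
    by (intro LIMSEQ_power_zero) simp
  \<comment> \<open>Numerator and denominator of the ratio are divided by (1 + s)^(k + 1), which
    leaves only powers of \<open>r\<close>, the quotient of the two roots.\<close>
  have "(\<lambda>k. ((1 + s) - (1 - s) * (r * r ^ k)) / (1 - r * r ^ k))
          \<longlonglongrightarrow> ((1 + s) - (1 - s) * (r * 0)) / (1 - r * 0)"
    by (intro tendsto_intros r) auto
  moreover have "((1 + s) - (1 - s) * (r * r ^ k)) / (1 - r * r ^ k)
      = lucas s (k + 2) / lucas s (k + 1)" for k
  proof -
    have eq: "(1 - s) ^ (k + 1) = (r * r ^ k) * (1 + s) ^ (k + 1)"
      using assms by (simp add: r_def power_divide)
    have "lucas s (k + 1) = (1 + s) ^ (k + 1) * (1 - r * r ^ k)"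
      using eq by (simp add: lucas_def algebra_simps)
    moreover have "lucas s (k + 2) = (1 + s) * (1 + s) ^ (k + 1) - (1 - s) * (1 - s) ^ (k + 1)"
      by (simp add: lucas_def)
    then have "lucas s (k + 2) = (1 + s) ^ (k + 1) * ((1 + s) - (1 - s) * (r * r ^ k))"
      unfolding eq by (simp add: algebra_simps)
    moreover have "(1 + s) ^ (k + 1) \<noteq> 0"
      using assms by simp
    ultimately show ?thesis
      by (simp del: power_Suc)
  qed
  ultimately show ?thesis
    by simp
qed

text \<open>Removing the first entry exchanges the two phases of the sequence, hence the joint
  induction. Each step is \<open>lucas_rec\<close> divided by \<open>lucas s (k + 2)\<close>, and in
  the second phase also by s^2 - 1. No denominator vanishes, because \<open>lucas\<close> is
  positive at positive indices whatever the sign of \<open>c\<close>.\<close>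

lemma cfrac_fin_alternating:
  assumes s: "0 < s" "s\<^sup>2 \<noteq> 1" and c: "c = 2 / (s\<^sup>2 - 1)"
  shows "cfrac_defined k (\<lambda>i. if even i then 2 else c)
      \<and> cfrac_fin k (\<lambda>i. if even i then 2 else c) = lucas s (k + 2) / lucas s (k + 1)"
    and "cfrac_defined k (\<lambda>i. if even i then c else 2)
      \<and> cfrac_fin k (\<lambda>i. if even i then c else 2)
          = lucas s (k + 2) / ((s\<^sup>2 - 1) * lucas s (k + 1))"
proof (induction k)
  case 0
  have "lucas s 1 \<noteq> 0" "lucas s 2 = 2 * lucas s 1"
    using lucas_rec[of s 0] lucas_pos[of s 1] s by (auto simp: lucas_def numeral_2_eq_2)
  then show "cfrac_defined 0 (\<lambda>i. if even i then 2 else c)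
      \<and> cfrac_fin 0 (\<lambda>i. if even i then 2 else c) = lucas s (0 + 2) / lucas s (0 + 1)"
    and "cfrac_defined 0 (\<lambda>i. if even i then c else 2)
      \<and> cfrac_fin 0 (\<lambda>i. if even i then c else 2)
          = lucas s (0 + 2) / ((s\<^sup>2 - 1) * lucas s (0 + 1))"
    by (simp_all add: c numeral_2_eq_2)
next
  case (Suc k)
  have swap: "(\<lambda>i. if even (Suc i) then x else y) = (\<lambda>i. if even i then y else x)" for x y :: real
    by auto
  have pos: "0 < lucas s (k + 1)" "0 < lucas s (k + 2)"
    using s by (simp_all add: lucas_pos)
  have rec: "lucas s (Suc k + 2) = 2 * lucas s (k + 2) + (s\<^sup>2 - 1) * lucas s (k + 1)"
    using lucas_rec[of s "k + 1"] by simp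
  have D: "s\<^sup>2 - 1 \<noteq> 0"
    using s by simp
  have k2: "Suc k + 1 = k + 2"
    by simp
  show "cfrac_defined (Suc k) (\<lambda>i. if even i then 2 else c)
      \<and> cfrac_fin (Suc k) (\<lambda>i. if even i then 2 else c) = lucas s (Suc k + 2) / lucas s (Suc k + 1)"
    unfolding cfrac_fin.simps cfrac_defined.simps swap k2 rec
    using Suc.IH(2) pos D by (simp add: add_divide_distrib)
  show "cfrac_defined (Suc k) (\<lambda>i. if even i then c else 2)
      \<and> cfrac_fin (Suc k) (\<lambda>i. if even i then c else 2)
          = lucas s (Suc k + 2) / ((s\<^sup>2 - 1) * lucas s (Suc k + 1))"
    unfolding cfrac_fin.simps cfrac_defined.simps swap k2 rec c
    using Suc.IH(1) pos D unfolding c by (simp add: add_divide_distrib)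
qed

lemma cfrac_periodic2:
  assumes s: "0 < s" "s\<^sup>2 \<noteq> 1" and c: "c = 2 / (s\<^sup>2 - 1)"
  shows "cfrac_defined k (periodic2 1 c 2)"
    and "cfrac_fin k (periodic2 1 c 2) = lucas s (k + 2) / lucas s (k + 1) - 1"
proof -
  have shift: "(\<lambda>i. periodic2 1 c 2 (Suc i)) = (\<lambda>i. if even (Suc i) then 2 else c)"
    by (auto simp: periodic2_def)
  \<comment> \<open>The expansion differs from the purely periodic \<open>[2, c, 2, c, \<dots>]\<close> only in its first entry.\<close>
  have "cfrac_defined k (periodic2 1 c 2) = cfrac_defined k (\<lambda>i. if even i then 2 else c)
      \<and> cfrac_fin k (periodic2 1 c 2) = cfrac_fin k (\<lambda>i. if even i then 2 else c) - 1"
    by (cases k) (simp_all only: cfrac_fin.simps cfrac_defined.simps shift,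
        simp_all add: periodic2_def)
  with cfrac_fin_alternating(1)[OF assms, of k]
  show "cfrac_defined k (periodic2 1 c 2)"
    and "cfrac_fin k (periodic2 1 c 2) = lucas s (k + 2) / lucas s (k + 1) - 1"
    by simp_all
qed

lemma has_cfrac_periodic2:
  assumes "0 < s" "s\<^sup>2 \<noteq> 1" "c = 2 / (s\<^sup>2 - 1)"
  shows "has_cfrac s (periodic2 1 c 2)"
  unfolding has_cfrac_def cfrac_periodic2(2)[OF assms]
  using cfrac_periodic2(1)[OF assms] tendsto_diff[OF lucas_ratio_tendsto[OF assms(1)] tendsto_const, of 1]
  by simp

text \<open>Here \<open>y k\<close> stands for a continuant of index k - 1, so that indices start at
  0. Rescaling turns the constant coefficients 2 and d into the entries 2 and 2 / d: each entry
  \<open>c\<close> contributes one factor 1 / d, and \<open>Suc k div 2\<close> counts the odd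
  indices up to k.\<close>

lemma continuant_periodic2:
  fixes y :: "nat \<Rightarrow> real"
  assumes d: "d \<noteq> 0" and c: "c = 2 / d"
    and w: "\<And>m. w (Suc (Suc m)) = 2 * w (Suc m) + d * w m"
    and y: "y 0 = w 0" "y 1 = w 1"
    and rec: "\<And>k. k \<ge> 1 \<Longrightarrow> y (Suc k) = periodic2 1 c 2 k * y k + y (k - 1)"
  shows "y (Suc k) = w (Suc k) / d ^ (Suc k div 2)"
proof -
  \<comment> \<open>One full period per step, since the exponent of \<open>d\<close> grows once in
    two indices.\<close>
  have two_steps: "y (2 * j + 1) = w (2 * j + 1) / d ^ j
      \<and> y (2 * j + 2) = w (2 * j + 2) / d ^ (j + 1)" for j
  proof (induction j)
    case 0
    have "y 2 = c * y 1 + y 0"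
      using rec[of 1] by (simp add: periodic2_def numeral_2_eq_2)
    moreover have "w 2 = 2 * w 1 + d * w 0"
      using w[of 0] by (simp add: numeral_2_eq_2)
    ultimately show ?case
      using d y by (simp add: c add_divide_distrib numeral_2_eq_2)
  next
    case (Suc j)
    have four: "(4::nat) = Suc (Suc (Suc (Suc 0)))"
      by simp
    have y3: "y (2 * j + 3) = 2 * y (2 * j + 2) + y (2 * j + 1)"
      using rec[of "2 * j + 2"] by (simp add: periodic2_def numeral_3_eq_3 four)
    have y4: "y (2 * j + 4) = c * y (2 * j + 3) + y (2 * j + 2)"
      using rec[of "2 * j + 3"] by (simp add: periodic2_def numeral_3_eq_3 four)
    have w3: "w (2 * j + 3) = 2 * w (2 * j + 2) + d * w (2 * j + 1)"
      using w[of "2 * j + 1"] by (simp add: numeral_3_eq_3 four)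
    have w4: "w (2 * j + 4) = 2 * w (2 * j + 3) + d * w (2 * j + 2)"
      using w[of "2 * j + 2"] by (simp add: numeral_3_eq_3 four)
    have y3': "y (2 * j + 3) = w (2 * j + 3) / d ^ (j + 1)"
      unfolding y3 w3 using Suc.IH d by (simp add: field_simps)
    have "y (2 * j + 4) = w (2 * j + 4) / d ^ (j + 2)"
      unfolding y4 y3' w4 c using Suc.IH d by (simp add: field_simps)
    with y3' show ?case
      by (simp add: numeral_3_eq_3 four)
  qed
  show ?thesis
  proof (cases "even k")
    case True
    then obtain j where "k = 2 * j" ..
    then show ?thesis
      using two_steps[of j] by simp
  next
    case False
    then obtain j where "k = 2 * j + 1"
      by (elim oddE)
    then show ?thesis
      using two_steps[of j] by simp
  qed
qed

text \<open>The assumption is invariant and excludes 0: if y^2 >= 4 then y^2 - 2 >= 2, and -1 is a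
  fixed point.\<close>

lemma square_minus_2_iterate_nonzero:
  fixes x :: real
  assumes "2 \<le> \<bar>x\<bar> \<or> x = -1"
  shows "((\<lambda>x. x * x - 2) ^^ j) x \<noteq> 0"
proof -
  have "2 \<le> \<bar>((\<lambda>x. x * x - 2) ^^ j) x\<bar> \<or> ((\<lambda>x. x * x - 2) ^^ j) x = -1"
  proof (induction j)
    case 0
    then show ?case
      using assms by simp
  next
    case (Suc j)
    have "4 \<le> y * y" if "2 \<le> \<bar>y\<bar>" for y :: real
      using mult_mono[OF that that] by simp
    with Suc show ?case
      by fastforce
  qed
  then show ?thesis
    by auto
qed

lemma square_minus_2_iterate_XB: "((\<lambda>x. x * x - 2) ^^ j) (XB j) = 0"
proof (induction j)
  case 0
  then show ?case
    by (simp add: XB_0)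
next
  case (Suc j)
  have "0 \<le> 2 + XB j"
    using cos_ge_minus_one[of "2 * pi / 2 ^ (j + 2)"] unfolding XB_def by linarith
  then have "XB (Suc j) * XB (Suc j) - 2 = XB j"
    by (simp add: XB_Suc)
  with Suc show ?case
    by (simp add: funpow_Suc_right del: funpow.simps)
qed

text \<open>This transfers the vanishing of an iterate to the conjugate without minimal polynomials.
  Membership in \<open>BF i\<close> is carried along because \<open>\<tau>\<close> is known to
  respect the operations only there.\<close>

lemma GB_iterate:
  assumes \<tau>: "\<tau> \<in> carrier (GB i)" and x: "x \<in> BF i"
  shows "((\<lambda>x. x * x - 2) ^^ j) x \<in> BF i
    \<and> \<tau> (((\<lambda>x. x * x - 2) ^^ j) x) = ((\<lambda>x. x * x - 2) ^^ j) (\<tau> x)"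
proof -
  have hom: "\<tau> \<in> ring_hom (real_field\<lparr>carrier := BF i\<rparr>) (real_field\<lparr>carrier := BF i\<rparr>)"
    and fixed: "\<And>x. x \<in> \<rat> \<Longrightarrow> \<tau> x = x"
    using \<tau> by (auto simp: GB_def Gal_def ring_iso_def)
  have rat: "x \<in> BF i" if "x \<in> \<rat>" for x
    unfolding BF_def using that by (intro generate_field.incl) simp
  have add: "x + y \<in> BF i" "\<tau> (x + y) = \<tau> x + \<tau> y" if "x \<in> BF i" "y \<in> BF i" for x y
    using that generate_field.eng_add[of x real_field "\<rat> \<union> {XB i}" y] ring_hom_add[OF hom, of x y]
    by (simp_all add: BF_def ring_of_type_algebra_def)
  have mult: "x * y \<in> BF i" "\<tau> (x * y) = \<tau> x * \<tau> y" if "x \<in> BF i" "y \<in> BF i" for x y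
    using that generate_field.eng_mult[of x real_field "\<rat> \<union> {XB i}" y] ring_hom_mult[OF hom, of x y]
    by (simp_all add: BF_def ring_of_type_algebra_def)
  have step: "y * y - 2 \<in> BF i \<and> \<tau> (y * y - 2) = \<tau> y * \<tau> y - 2" if "y \<in> BF i" for y
    using add[OF mult(1)[OF that that] rat[of "-2"]] mult(2)[OF that that] fixed[of "-2"] by simp
  show ?thesis
    using x step by (induction j) auto
qed

text \<open>The first bound makes the radicand positive, the second keeps the denominator in
  \<open>c\<close> away from 0.\<close>

lemma GB_XB_bounds:
  assumes "\<tau> \<in> carrier (GB i)"
  shows "\<bar>\<tau> (XB i)\<bar> < 2" "\<tau> (XB i) \<noteq> -1"
proof -
  have "XB i \<in> BF i"
    unfolding BF_def by (intro generate_field.incl) simp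
  then have "((\<lambda>x. x * x - 2) ^^ i) (\<tau> (XB i)) = \<tau> 0"
    using GB_iterate[OF assms, of "XB i" i] by (simp add: square_minus_2_iterate_XB)
  also have "\<tau> 0 = 0"
    using assms by (auto simp: GB_def Gal_def)
  finally show "\<bar>\<tau> (XB i)\<bar> < 2" "\<tau> (XB i) \<noteq> -1"
    using square_minus_2_iterate_nonzero[of "\<tau> (XB i)" i] by force+
qed

theorem theorem3p3:
  fixes n :: nat and \<tau> :: "real \<Rightarrow> real" and c :: real
    and a :: "nat \<Rightarrow> real" and p q :: "int \<Rightarrow> real"
  assumes "n \<ge> 1"
    and "\<tau> \<in> carrier (GB (n - 1))"
    and "c = 2 * inverse (1 + \<tau> (XB (n - 1)))"
    and "a 0 = 1"
    and "\<And>k. k \<ge> 1 \<Longrightarrow> a (2 * k - 1) = c"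
    and "\<And>k. k \<ge> 1 \<Longrightarrow> a (2 * k) = 2"
    and "p (-1) = 1" and "p 0 = a 0"
    and "q (-1) = 0" and "q 0 = 1"
    and "\<And>k::nat. k \<ge> 1 \<Longrightarrow> p (int k) = a k * p (int k - 1) + p (int k - 2)"
    and "\<And>k::nat. k \<ge> 1 \<Longrightarrow> q (int k) = a k * q (int k - 1) + q (int k - 2)"
  shows "(\<forall>k::nat. q (int k) \<noteq> 0)
    \<and> convergent (\<lambda>k::nat. p (int k) / q (int k))
    \<and> sqrt (2 + \<tau> (XB (n - 1))) = lim (\<lambda>k::nat. p (int k) / q (int k))
    \<and> has_cfrac (lim (\<lambda>k::nat. p (int k) / q (int k)))
        (periodic2 1 (2 * inverse (1 + \<tau> (XB (n - 1)))) 2)"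
proof -
  define t where "t = \<tau> (XB (n - 1))"
  define s where "s = sqrt (2 + t)"
  have t: "\<bar>t\<bar> < 2" "t \<noteq> -1"
    unfolding t_def using GB_XB_bounds[OF assms(2)] by auto
  have s: "0 < s" and s2: "s\<^sup>2 = 2 + t"
    using t by (auto simp: s_def)
  have D: "s\<^sup>2 \<noteq> 1" and c: "c = 2 / (s\<^sup>2 - 1)"
    using t assms(3) by (auto simp: s2 t_def divide_inverse)
  have D': "s\<^sup>2 - 1 \<noteq> 0"
    using D by simp
  have a: "a = periodic2 1 c 2"
  proof
    fix i :: nat
    show "a i = periodic2 1 c 2 i"
    proof (cases "even i")
      case True
      then obtain j where "i = 2 * j" ..
      then show ?thesis
        using assms(4) assms(6)[of j] by (cases "j = 0") (simp_all add: periodic2_def)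
    next
      case False
      then obtain j where "i = 2 * j + 1"
        by (elim oddE)
      then show ?thesis
        using assms(5)[of "j + 1"] by (simp add: periodic2_def)
    qed
  qed
  let ?L = "lucas s"
  have L: "?L 0 = 0" "?L 1 = 2 * s" "?L 2 = 4 * s"
    by (simp_all add: lucas_def power2_eq_square algebra_simps)
  \<comment> \<open>The initial values 0, 1 of q at -1, 0 are those of
    \<open>?L m / (2 * s)\<close>.\<close>
  have q: "q (int k) = ?L (k + 1) / (2 * s) / (s\<^sup>2 - 1) ^ (Suc k div 2)" for k
  proof -
    have "q (int (Suc k) - 1) = ?L (Suc k) / (2 * s) / (s\<^sup>2 - 1) ^ (Suc k div 2)"
    proof (rule continuant_periodic2[OF D' c, where y = "\<lambda>k. q (int k - 1)" and w = "\<lambda>m. ?L m / (2 * s)"])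
      fix k :: nat assume "k \<ge> 1"
      then show "q (int (Suc k) - 1) = periodic2 1 c 2 k * q (int k - 1) + q (int (k - 1) - 1)"
        using assms(12)[of k] by (simp add: a of_nat_diff)
    qed (use assms(9,10) L s in \<open>simp_all add: lucas_rec add_divide_distrib\<close>)
    then show ?thesis
      by simp
  qed
  \<comment> \<open>The initial values 1, 1 call for the difference of two consecutive Lucas terms,
    which satisfies the same linear recurrence.\<close>
  have p: "p (int k) = (?L (k + 2) - ?L (k + 1)) / (2 * s) / (s\<^sup>2 - 1) ^ (Suc k div 2)" for k
  proof -
    have "p (int (Suc k) - 1) = (?L (Suc (Suc k)) - ?L (Suc k)) / (2 * s) / (s\<^sup>2 - 1) ^ (Suc k div 2)"
    proof (rule continuant_periodic2[OF D' c, where y = "\<lambda>k. p (int k - 1)"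
          and w = "\<lambda>m. (?L (Suc m) - ?L m) / (2 * s)"])
      fix k :: nat assume "k \<ge> 1"
      then show "p (int (Suc k) - 1) = periodic2 1 c 2 k * p (int k - 1) + p (int (k - 1) - 1)"
        using assms(11)[of k] by (simp add: a of_nat_diff)
    next
      fix m
      show "(?L (Suc (Suc (Suc m))) - ?L (Suc (Suc m))) / (2 * s)
          = 2 * ((?L (Suc (Suc m)) - ?L (Suc m)) / (2 * s)) + (s\<^sup>2 - 1) * ((?L (Suc m) - ?L m) / (2 * s))"
        unfolding lucas_rec[of s "Suc m"] lucas_rec[of s m] by (simp add: algebra_simps add_divide_distrib diff_divide_distrib)
    qed (use assms(4,7,8) L s in \<open>simp_all add: numeral_2_eq_2\<close>)
    then show ?thesis
      by simp
  qed
  have L_pos: "0 < ?L (k + 1)" for k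
    using s by (simp add: lucas_pos)
  have q_nonzero: "q (int k) \<noteq> 0" for k
    unfolding q using L_pos[of k] D' s by simp
  \<comment> \<open>Both continuants carry the same power of s^2 - 1, so it cancels together with
    \<open>2 * s\<close>.\<close>
  have "p (int k) / q (int k) = (?L (k + 2) - ?L (k + 1)) / ?L (k + 1)" for k
    unfolding p q using D' s by simp
  then have "p (int k) / q (int k) = ?L (k + 2) / ?L (k + 1) - 1" for k
    using L_pos[of k] by (simp add: diff_divide_distrib)
  then have lim: "(\<lambda>k. p (int k) / q (int k)) \<longlonglongrightarrow> s"
    using tendsto_diff[OF lucas_ratio_tendsto[OF s] tendsto_const, of 1] by simp
  then have "lim (\<lambda>k. p (int k) / q (int k)) = s"
    by (rule limI)
  \<comment> \<open>This comes from evaluating the nested fractions directly, independently of the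
    continuants.\<close>
  moreover have "has_cfrac s (periodic2 1 (2 * inverse (1 + \<tau> (XB (n - 1)))) 2)"
    using has_cfrac_periodic2[OF s D c] assms(3) by simp
  ultimately show ?thesis
    using q_nonzero lim by (auto simp: convergent_def s_def t_def)
qed

end
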